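(* Let $n\ge 2$ be an integer and $q$ a prime power. There exist $N\ge 1$ and a cyclic sequence $\mathcal{C}=(p_i)_{i\in\mathbb{Z}/N\mathbb{Z}}$ of points of $\mathrm{PG}(n,q)$ such that (1) for every $i$, the window $(p_i,p_{i+1})$ represents a well-defined affine line of $\mathrm{AG}(n,q)$, and (2) every affine line of $\mathrm{AG}(n,q)$ is represented by exactly one window $(p_i,p_{i+1})$, $i\in\mathbb{Z}/N\mathbb{Z}$. (The points $p_i$ may be affine points or points at infinity.)
   Context: $\mathrm{AG}(n,q)$ denotes the affine space $\mathbb{F}_q^{\,n}$; its affine lines are the sets $x+\ell$ with $x\in\mathbb{F}_q^{\,n}$ and $\ell\subset\mathbb{F}_q^{\,n}$ a $1$-dimensional linear subspace (the direction of the line). $\mathrm{PG}(n,q)$ is the projective completion of $\mathrm{AG}(n,q)$: its points are the affine points $x\in\mathbb{F}_q^{\,n}$ together with the points of the hyperplane at infinity, which are the symbols $[\ell]$, one for each $1$-dimensional subspace $\ell\subset\mathbb{F}_q^{\,n}$. A window $(p,p')$ of two points of $\mathrm{PG}(n,q)$ represents an affine line as follows: if $p,p'$ are distinct affine points, it represents the unique affine line through $p$ and $p'$; if one of them is an affine point $x$ and the other is a point at infinity $[\ell]$, it represents the affine line $x+\ell$; in all other cases (equal points, or two points at infinity) the window does not represent an affine line. *)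

theory Defs
  imports "HOL-Analysis.Cartesian_Space"
begin

definition directions :: "('a::field ^ 'n) set set" where
  "directions = {l. vec.subspace l \<and> vec.dim l = 1}"

definition affine_lines :: "('a::field ^ 'n) set set" where
  "affine_lines = {(+) x ` l | x l. l \<in> directions}"

(* AtInfinity l is a point of PG(n,q) only if l is a direction; see PG_points. *)
datatype 'v pg_point = Affine 'v | AtInfinity "'v set"

definition PG_points :: "('a::field ^ 'n) pg_point set" where
  "PG_points = range Affine \<union> AtInfinity ` directions"

fun represents ::
  "('a::field ^ 'n) pg_point \<Rightarrow> ('a ^ 'n) pg_point \<Rightarrow> ('a ^ 'n) set \<Rightarrow> bool" where
  "represents (Affine x) (Affine y) L \<longleftrightarrow>
     x \<noteq> y \<and> L \<in> affine_lines \<and> x \<in> L \<and> y \<in> L"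
| "represents (Affine x) (AtInfinity l) L \<longleftrightarrow> l \<in> directions \<and> L = (+) x ` l"
| "represents (AtInfinity l) (Affine x) L \<longleftrightarrow> l \<in> directions \<and> L = (+) x ` l"
| "represents (AtInfinity l) (AtInfinity l') L \<longleftrightarrow> False"

end

theory Submission
  imports Defs "HOL-Library.Multiset"
begin

text \<open>
  Split the set of directions into pairs, together with one triple if their number is odd, and
  cover the lines of each part by a closed walk through the origin; these walks concatenate.
  For directions \<open>\<langle>u\<rangle>\<close>, \<open>\<langle>v\<rangle>\<close> take a linear form \<open>\<phi>\<close> with \<open>\<phi> u = \<phi> v = 1\<close>. Every line in either
  direction meets \<open>T = ker \<phi>\<close> once, so the walk
  \<open>0, [\<langle>u\<rangle>], t\<^sub>1, [\<langle>v\<rangle>], t\<^sub>2, [\<langle>u\<rangle>], \<dots>\<close> through the elements of \<open>T\<close> closes up when \<open>|T|\<close> is even; when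
  it is odd, end at \<open>v - u \<in> T\<close> and return by \<open>v - u, v, 0\<close>.
  For three directions with \<open>\<phi> u = \<phi> v = \<phi> w = 1\<close>, replace the passage from \<open>s\<close> to \<open>t\<close> via
  infinity by \<open>s, s + w, [\<langle>v\<rangle>], t + w, t\<close> at every other step, and
  return by \<open>2u - v - w, 2u - v, 2u, 0\<close> when \<open>|T|\<close> is odd. If the number of directions is odd, a
  suitable triple exists unless \<open>n = q = 2\<close>, where a hexagon covers all six lines.
\<close>

section \<open>Directions and lines given by a spanning vector\<close>

definition dir :: "'a::field ^ 'n \<Rightarrow> ('a ^ 'n) set" where
  "dir u = range (\<lambda>c. c *s u)"

text \<open>For \<open>D = directions\<close> this is \<open>affine_lines\<close>; a general
  \<open>D\<close> allows the lines to be covered one small set of directions at a time.\<close>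

definition lines_along :: "('a::field ^ 'n) set set \<Rightarrow> ('a ^ 'n) set set" where
  "lines_along D = {(+) x ` l | x l. l \<in> D}"

lemma dir_eq_span: "dir u = vec.span {u}"
  by (simp add: dir_def vec.span_singleton)

lemma dir_in_directions:
  assumes "u \<noteq> 0" shows "dir u \<in> directions"
  using assms unfolding directions_def dir_eq_span
  by (simp add: vec.dim_span_eq_card_independent)

lemma directionsE:
  assumes "l \<in> directions"
  obtains u where "u \<noteq> 0" "l = dir u"
proof -
  have sub: "vec.subspace l" and dim: "vec.dim l = 1"
    using assms by (auto simp: directions_def)
  obtain B where B: "B \<subseteq> l" "vec.independent B" "l \<subseteq> vec.span B" "card B = vec.dim l"
    using vec.basis_exists by blast
  then obtain u where u: "B = {u}"
    using dim by (metis card_1_singletonE)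
  have "u \<noteq> 0" using B(2) u by (metis vec.dependent_zero singletonI)
  moreover have "l = dir u"
    unfolding dir_eq_span using B sub u vec.span_minimal[of B l] by blast
  ultimately show thesis by (rule that)
qed

lemma zero_in_dir: "0 \<in> dir u"
  unfolding dir_def by (metis rangeI vector_smult_lzero)

lemma self_in_dir: "u \<in> dir u"
  unfolding dir_def by (metis rangeI vec.scale_one)

lemma scale_in_dir [simp]: "c *s u \<in> dir u"
  by (auto simp: dir_def)

lemma dir_scale: "c \<noteq> 0 \<Longrightarrow> dir (c *s u) = dir u"
  by (simp add: dir_eq_span vec.span_singleton image_def)
     (metis (no_types, opaque_lifting) nonzero_eq_divide_eq vector_smult_assoc)

text \<open>Coset criterion for the subspace \<open>dir u\<close>; it serves to change the base
  point of a line.\<close>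

lemma translate_dir_eq_iff: "(+) x ` dir u = (+) y ` dir u \<longleftrightarrow> x - y \<in> dir u"
proof
  assume "(+) x ` dir u = (+) y ` dir u"
  then have "x + 0 \<in> (+) y ` dir u" using zero_in_dir by blast
  then show "x - y \<in> dir u" by auto
next
  have sub: "(+) x ` dir u \<subseteq> (+) y ` dir u" if "x - y \<in> dir u" for x y
  proof
    fix z assume "z \<in> (+) x ` dir u"
    then obtain d where d: "d \<in> dir u" "z = x + d" by blast
    then have "(x - y) + d \<in> dir u"
      using that unfolding dir_eq_span by (metis vec.span_add)
    moreover have "z = y + ((x - y) + d)" by (simp add: d)
    ultimately show "z \<in> (+) y ` dir u" by blast
  qed
  assume *: "x - y \<in> dir u"
  then have "y - x \<in> dir u"
    unfolding dir_eq_span by (metis minus_diff_eq vec.span_neg)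
  with * show "(+) x ` dir u = (+) y ` dir u" using sub by blast
qed

lemma line_through_two_points:
  assumes "L \<in> affine_lines" "x \<in> L" "y \<in> L" "x \<noteq> y"
  shows "L = (+) x ` dir (y - x)"
proof -
  obtain z l where "L = (+) z ` l" "l \<in> directions"
    using assms(1) by (auto simp: affine_lines_def)
  then obtain u where L: "L = (+) z ` dir u" by (metis directionsE)
  obtain a b where ab: "x = z + a *s u" "y = z + b *s u"
    using assms(2,3) by (auto simp: L dir_def)
  have "y - x = (b - a) *s u" by (simp add: ab vec.scale_left_diff_distrib)
  moreover have "b - a \<noteq> 0" using assms(4) ab by auto
  ultimately have "dir (y - x) = dir u" by (simp add: dir_scale)
  moreover have "x - z \<in> dir u" by (simp add: ab)
  ultimately show ?thesis by (simp add: L translate_dir_eq_iff[symmetric])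
qed

text \<open>Two distinct affine points lie on only one line, and a window with one point at infinity
  names its line explicitly.\<close>

lemma represents_unique:
  assumes "represents p q L" "represents p q L'"
  shows "L = L'"
  using assms line_through_two_points
  by (cases "(p, q, L)" rule: represents.cases) (auto, blast+)

lemma represents_affine:
  assumes "y - x \<in> dir u" "y \<noteq> x"
  shows "represents (Affine x) (Affine y) ((+) x ` dir u)"
proof -
  have "u \<noteq> 0" using assms by (auto simp: dir_def)
  then have "(+) x ` dir u \<in> affine_lines"
    using dir_in_directions by (auto simp: affine_lines_def)
  moreover have "x \<in> (+) x ` dir u" using zero_in_dir by force
  moreover have "y \<in> (+) x ` dir u" using assms(1) by (metis add.commute diff_add_cancel imageI)
  ultimately show ?thesis using assms(2) by auto
qed

section \<open>Walks in the projective completion\<close>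

lemma Affine_in_PG_points: "Affine x \<in> PG_points"
  by (simp add: PG_points_def)

lemma AtInfinity_in_PG_points: "l \<in> directions \<Longrightarrow> AtInfinity l \<in> PG_points"
  by (simp add: PG_points_def)

text \<open>\<open>conn p q M\<close>: some walk from \<open>p\<close> to \<open>q\<close> has windows representing the lines in \<open>M\<close>,
  counted with multiplicity.\<close>

inductive conn ::
  "('a::field ^ 'n) pg_point \<Rightarrow> ('a ^ 'n) pg_point \<Rightarrow> ('a ^ 'n) set multiset \<Rightarrow> bool" where
  conn_Nil: "p \<in> PG_points \<Longrightarrow> conn p p {#}"
| conn_Cons: "p \<in> PG_points \<Longrightarrow> represents p p' L \<Longrightarrow> conn p' q M \<Longrightarrow> conn p q (add_mset L M)"

lemma conn_append: "conn p q M \<Longrightarrow> conn q r M' \<Longrightarrow> conn p r (M + M')"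
  by (induction rule: conn.induct) (auto intro: conn_Cons)

text \<open>Indexed form of a walk, for the final passage to a cyclic sequence. There is one more
  point than there are windows, because both endpoints are listed.\<close>

lemma conn_imp_lists:
  assumes "conn p q M"
  shows "\<exists>ps Ls. length ps = Suc (length Ls) \<and> ps ! 0 = p \<and> ps ! length Ls = q \<and>
    set ps \<subseteq> PG_points \<and> mset Ls = M \<and>
    (\<forall>i<length Ls. represents (ps ! i) (ps ! Suc i) (Ls ! i))"
  using assms
proof induction
  case (conn_Nil p)
  then show ?case by (intro exI[of _ "[p]"] exI[of _ "[]"]) auto
next
  case (conn_Cons p p' L q M)
  then obtain ps Ls where *: "length ps = Suc (length Ls)" "ps ! 0 = p'" "ps ! length Ls = q"
    "set ps \<subseteq> PG_points" "mset Ls = M"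
    "\<forall>i<length Ls. represents (ps ! i) (ps ! Suc i) (Ls ! i)"
    by blast
  then show ?case using conn_Cons.hyps
    by (intro exI[of _ "p # ps"] exI[of _ "L # Ls"]) (auto simp: less_Suc_eq_0_disj)
qed

text \<open>The walk \<open>x, [l], y\<close>. Its endpoints are arbitrary, so parallel lines can be
  visited in any order.\<close>

lemma conn_via_infinity:
  assumes "l \<in> directions"
  shows "conn (Affine x) (Affine y) {#(+) x ` l, (+) y ` l#}"
proof -
  have "conn (AtInfinity l) (Affine y) {#(+) y ` l#}"
    using assms
    by (intro conn_Cons[where p' = "Affine y"] conn_Nil Affine_in_PG_points AtInfinity_in_PG_points)
      auto
  then show ?thesis
    using assms Affine_in_PG_points by (metis conn_Cons represents.simps(2))
qed

lemma conn_affine: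
  assumes "y - x \<in> dir u" "y \<noteq> x"
  shows "conn (Affine x) (Affine y) {#(+) x ` dir u#}"
  using represents_affine[OF assms]
  by (intro conn_Cons[where p' = "Affine y"] conn_Nil Affine_in_PG_points)

text \<open>The walk alternates \<open>\<alpha>\<close>-steps and \<open>\<beta>\<close>-steps, so each intermediate \<open>t\<close> is entered by one kind
  and left by the other; \<open>a\<close> still lacks its \<open>\<beta>\<close>-lines and \<open>b\<close> its \<open>\<alpha>\<close>-lines.\<close>

lemma conn_zigzag:
  assumes \<alpha>: "\<And>s t. conn (Affine s) (Affine t) (\<alpha> s + \<alpha> t)"
    and \<beta>: "\<And>s t. conn (Affine s) (Affine t) (\<beta> s + \<beta> t)"
    and "finite M" "odd (card M)"
  shows "conn (Affine a) (Affine b) (\<alpha> a + (\<Sum>t\<in>M. \<alpha> t + \<beta> t) + \<beta> b)"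
  using assms(3,4)
proof (induction "card M" arbitrary: M a rule: less_induct)
  case less
  then obtain m where m: "m \<in> M" by fastforce
  show ?case
  proof (cases "M = {m}")
    case True
    then show ?thesis using conn_append[OF \<alpha>[of a m] \<beta>[of m b]] by (simp add: ac_simps)
  next
    case False
    then obtain m' where m': "m' \<in> M" "m' \<noteq> m" using m by blast
    define M' where "M' = M - {m, m'}"
    have M: "M = insert m (insert m' M')" "m \<notin> insert m' M'" "m' \<notin> M'" "finite M'"
      using m m' less.prems by (auto simp: M'_def)
    then have c: "card M = Suc (Suc (card M'))" by simp
    then have "conn (Affine m') (Affine b) (\<alpha> m' + (\<Sum>t\<in>M'. \<alpha> t + \<beta> t) + \<beta> b)"
      using less.prems M by (intro less.hyps) auto
    \<comment> \<open>The steps from \<open>a\<close> to \<open>m\<close> to \<open>m'\<close> use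
      up both families at \<open>m\<close>; then \<open>m'\<close> takes over the role of
      \<open>a\<close>, and \<open>M'\<close> again has odd size.\<close>
    from conn_append[OF conn_append[OF \<alpha>[of a m] \<beta>[of m m']] this]
    show ?thesis using M by (simp add: ac_simps)
  qed
qed

text \<open>If \<open>card T\<close> is even, \<open>T - {a}\<close> is odd and the alternating walk
  returns to \<open>a\<close>. Otherwise \<open>T - {a, b}\<close> is odd, the walk ends at
  \<open>b\<close>, and exactly \<open>\<alpha> b\<close> and \<open>\<beta> a\<close> are left for
  the assumed return walk.\<close>

lemma conn_zigzag_closed:
  assumes \<alpha>: "\<And>s t. conn (Affine s) (Affine t) (\<alpha> s + \<alpha> t)"
    and \<beta>: "\<And>s t. conn (Affine s) (Affine t) (\<beta> s + \<beta> t)"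
    and T: "finite T" "a \<in> T"
    and odd: "odd (card T) \<Longrightarrow>
      b \<in> T \<and> b \<noteq> a \<and> conn (Affine b) (Affine a) (\<alpha> b + \<beta> a)"
  shows "conn (Affine a) (Affine a) (\<Sum>t\<in>T. \<alpha> t + \<beta> t)"
proof (cases "even (card T)")
  case True
  have "card T = Suc (card (T - {a}))" using T by (metis card.remove)
  then have "conn (Affine a) (Affine a) (\<alpha> a + (\<Sum>t\<in>T - {a}. \<alpha> t + \<beta> t) + \<beta> a)"
    using True T by (intro conn_zigzag \<alpha> \<beta>) auto
  then show ?thesis using T by (simp add: sum.remove[of T a] ac_simps)
next
  case False
  note b = odd[OF this]
  define M where "M = T - {a, b}"
  have M: "T = insert a (insert b M)" "a \<notin> insert b M" "b \<notin> M" "finite M"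
    using b T by (auto simp: M_def)
  then have "card T = Suc (Suc (card M))" by simp
  then have "conn (Affine a) (Affine b) (\<alpha> a + (\<Sum>t\<in>M. \<alpha> t + \<beta> t) + \<beta> b)"
    using False M by (intro conn_zigzag \<alpha> \<beta>) auto
  from conn_append[OF this conjunct2[OF conjunct2[OF b]]]
  show ?thesis using M by (simp add: ac_simps)
qed

section \<open>Sets of directions whose lines form a closed walk\<close>

text \<open>All walks are based at the origin so that walks for disjoint sets of directions can be
  concatenated.\<close>

definition solvable :: "('a::field ^ 'n) set set \<Rightarrow> bool" where
  "solvable D \<longleftrightarrow> conn (Affine 0) (Affine 0) (mset_set (lines_along D))"

text \<open>A line determines its direction: rebased at a common point, equal translates have equal
  subspaces.\<close>

lemma lines_along_disjoint:
  assumes "D \<subseteq> directions" "D' \<subseteq> directions" "D \<inter> D' = {}"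
  shows "lines_along D \<inter> lines_along D' = {}"
proof (rule ccontr)
  assume "lines_along D \<inter> lines_along D' \<noteq> {}"
  then obtain x l y l' where *: "(+) x ` l = (+) y ` l'" "l \<in> D" "l' \<in> D'"
    by (auto simp: lines_along_def)
  obtain u v where l: "l = dir u" "l' = dir v"
    using *(2,3) assms(1,2) by (meson directionsE subsetD)
  have "x \<in> (+) y ` l'" using *(1) zero_in_dir[of u] l by force
  then have "(+) x ` l' = (+) y ` l'" by (auto simp: l translate_dir_eq_iff)
  then have "(+) x ` l = (+) x ` l'" using *(1) by simp
  then have "l = l'" by (simp add: inj_image_eq_iff)
  then show False using * assms(3) by blast
qed

lemma solvable_Un:
  fixes D D' :: "('a::{field,finite} ^ 'n) set set"
  assumes "solvable D" "solvable D'" "D \<subseteq> directions" "D' \<subseteq> directions" "D \<inter> D' = {}"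
  shows "solvable (D \<union> D')"
proof -
  have "lines_along (D \<union> D') = lines_along D \<union> lines_along D'"
    by (auto simp: lines_along_def)
  then have "mset_set (lines_along (D \<union> D')) = mset_set (lines_along D) + mset_set (lines_along D')"
    using lines_along_disjoint[OF assms(3-5)] by (simp add: mset_set_Union)
  then show ?thesis using conn_append assms(1,2) unfolding solvable_def by metis
qed

section \<open>Two or three directions normalised by a linear form\<close>

locale linear_form =
  fixes \<phi> :: "'a::{field,finite} ^ 'n \<Rightarrow> 'a"
  assumes add: "\<phi> (x + y) = \<phi> x + \<phi> y"
    and scale: "\<phi> (c *s x) = c * \<phi> x"
begin

definition ker :: "('a ^ 'n) set" where
  "ker = {x. \<phi> x = 0}"

lemma diff: "\<phi> (x - y) = \<phi> x - \<phi> y"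
  by (metis add add_diff_cancel_right' diff_add_cancel)

lemma zero: "\<phi> 0 = 0"
  using scale[of 0 0] by simp

lemma zero_in_ker: "0 \<in> ker"
  by (simp add: ker_def zero)

text \<open>Parallel vectors differ by a scalar, and the normalisation forces this scalar to be
  1.\<close>

lemma dir_neq:
  assumes "\<phi> u = 1" "\<phi> v = 1" "u \<noteq> v"
  shows "dir u \<noteq> dir v"
proof
  assume "dir u = dir v"
  then obtain c where c: "u = c *s v" using self_in_dir[of u] by (auto simp: dir_def)
  then have "c = 1" using assms by (simp add: scale)
  then show False using c assms by simp
qed

text \<open>A line along \<open>u\<close> meets the hyperplane \<open>w + ker\<close> exactly once.
  The shift \<open>w\<close> is there for triples, where the lines along \<open>v\<close> are
  indexed by their points \<open>t + w\<close>.\<close>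

lemma lines_along_dir:
  assumes "\<phi> u = 1"
  shows "mset_set (lines_along {dir u}) = (\<Sum>t\<in>ker. {#(+) (t + w) ` dir u#})"
proof -
  let ?f = "\<lambda>t. (+) (t + w) ` dir u"
  have "inj_on ?f ker"
  proof (rule inj_onI)
    fix s t assume st: "s \<in> ker" "t \<in> ker" "?f s = ?f t"
    then have "s - t \<in> dir u" by (simp add: translate_dir_eq_iff)
    then obtain c where c: "s - t = c *s u" by (auto simp: dir_def)
    then have "c = \<phi> (s - t)" using assms by (simp add: scale)
    then have "c = 0" using st by (simp add: ker_def diff)
    then show "s = t" using c by simp
  qed
  moreover have "lines_along {dir u} = ?f ` ker"
  proof (intro equalityI subsetI)
    fix L assume "L \<in> lines_along {dir u}"
    then obtain x where L: "L = (+) x ` dir u" by (auto simp: lines_along_def)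
    \<comment> \<open>\<open>t + w\<close> is the point where \<open>L\<close> meets
      \<open>w + ker\<close>: \<open>t\<close> is the projection of \<open>x - w\<close> to
      \<open>ker\<close> along \<open>u\<close>.\<close>
    define t where "t = x - w - \<phi> (x - w) *s u"
    have "t \<in> ker" using assms by (simp add: ker_def t_def diff scale)
    moreover have "x - (t + w) = \<phi> (x - w) *s u" by (simp add: t_def)
    then have "L = ?f t" unfolding L translate_dir_eq_iff by simp
    ultimately show "L \<in> ?f ` ker" by blast
  qed (auto simp: lines_along_def)
  ultimately have "mset_set (lines_along {dir u}) = image_mset ?f (mset_set ker)"
    by (simp add: image_mset_mset_set)
  also have "\<dots> = (\<Sum>t\<in>ker. {#?f t#})"
    by (induction rule: finite_induct[OF finite[of ker]]) auto
  finally show ?thesis .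
qed

lemma solvable_pair:
  assumes u: "\<phi> u = 1" and v: "\<phi> v = 1" and "u \<noteq> v"
  shows "solvable {dir u, dir v}"
proof -
  have nz: "u \<noteq> 0" "v \<noteq> 0" using u v zero by auto
  define \<alpha> \<beta> where "\<alpha> = (\<lambda>t. {#(+) t ` dir u#})" and "\<beta> = (\<lambda>t. {#(+) t ` dir v#})"
  have "conn (Affine 0) (Affine 0) (\<Sum>t\<in>ker. \<alpha> t + \<beta> t)"
  proof (rule conn_zigzag_closed[where b = "v - u"])
    fix s t
    show "conn (Affine s) (Affine t) (\<alpha> s + \<alpha> t)"
      using conn_via_infinity[OF dir_in_directions[OF nz(1)], of s t]
      by (simp add: \<alpha>_def add_mset_commute)
    show "conn (Affine s) (Affine t) (\<beta> s + \<beta> t)"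
      using conn_via_infinity[OF dir_in_directions[OF nz(2)], of s t]
      by (simp add: \<beta>_def add_mset_commute)
  next
    \<comment> \<open>The return walk \<open>v - u, v, 0\<close> covers the \<open>u\<close>-line
      through \<open>v - u\<close> and the \<open>v\<close>-line through \<open>0\<close>, the two
      lines still missing.\<close>
    have "conn (Affine (v - u)) (Affine v) (\<alpha> (v - u))"
      unfolding \<alpha>_def using nz self_in_dir by (intro conn_affine) auto
    moreover have "conn (Affine v) (Affine 0) {#(+) v ` dir v#}"
      using nz by (intro conn_affine) (auto simp: dir_eq_span vec.span_neg vec.span_base)
    moreover have "{#(+) v ` dir v#} = \<beta> 0"
      unfolding \<beta>_def using translate_dir_eq_iff[of v v 0] self_in_dir[of v] by simp
    ultimately have "conn (Affine (v - u)) (Affine 0) (\<alpha> (v - u) + \<beta> 0)"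
      using conn_append by metis
    then show "v - u \<in> ker \<and> v - u \<noteq> 0 \<and> conn (Affine (v - u)) (Affine 0) (\<alpha> (v - u) + \<beta> 0)"
      using assms by (simp add: ker_def diff)
  qed (simp_all add: zero_in_ker)
  moreover have "(\<Sum>t\<in>ker. \<alpha> t + \<beta> t) =
      mset_set (lines_along {dir u}) + mset_set (lines_along {dir v})"
    using lines_along_dir[OF u, of 0] lines_along_dir[OF v, of 0]
    by (simp add: \<alpha>_def \<beta>_def sum.distrib[symmetric] add_mset_commute)
  moreover have "\<dots> = mset_set (lines_along {dir u} \<union> lines_along {dir v})"
    using lines_along_disjoint[of "{dir u}" "{dir v}"] dir_neq[OF assms]
      nz[THEN dir_in_directions]
    by (subst mset_set_Union) auto
  moreover have "lines_along {dir u} \<union> lines_along {dir v} = lines_along {dir u, dir v}"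
    by (auto simp: lines_along_def)
  ultimately show ?thesis by (simp add: solvable_def)
qed

text \<open>In characteristic 2, translation by \<open>s\<close> is an involution of
  \<open>ker\<close> without fixed points, so \<open>ker\<close> splits into pairs.\<close>

lemma even_card_ker:
  assumes "(2::'a) = 0" "s \<in> ker" "s \<noteq> 0"
  shows "even (card ker)"
proof -
  have ss: "s + s = 0"
  proof -
    have "s + s = 2 *s s" by (metis one_add_one vec.scale_left_distrib vec.scale_one)
    then show ?thesis using assms by simp
  qed
  have ss': "x + s + s = x" for x using ss by (simp add: add.assoc)
  let ?C = "(\<lambda>x. {x, x + s}) ` ker"
  have "\<Union>?C = ker" using assms by (auto simp: ker_def add)
  moreover have "2 dvd card (\<Union>?C)"
  proof (rule dvd_partition)
    show "\<forall>c\<in>?C. 2 dvd card c" using assms by auto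
    show "\<forall>c1\<in>?C. \<forall>c2\<in>?C. c1 \<noteq> c2 \<longrightarrow> c1 \<inter> c2 = {}"
      using ss' by (auto simp: insert_commute)
  qed auto
  ultimately show ?thesis by simp
qed

lemma solvable_triple:
  assumes u: "\<phi> u = 1" and v: "\<phi> v = 1" and w: "\<phi> w = 1"
    and neq: "u \<noteq> v" "u \<noteq> w" "v \<noteq> w"
    and odd: "odd (card ker) \<Longrightarrow> 2 *s u - v \<noteq> w"
  shows "solvable {dir u, dir v, dir w}"
proof -
  have nz: "u \<noteq> 0" "v \<noteq> 0" "w \<noteq> 0" using u v w zero by auto
  \<comment> \<open>\<open>\<alpha>\<close> bundles the directions of \<open>w\<close> and
    \<open>v\<close>: from \<open>t\<close> one moves along \<open>w\<close> to \<open>t + w\<close>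
    and leaves there along \<open>v\<close>. This reduces three directions to two alternating
    families.\<close>
  define \<alpha> \<beta> where "\<alpha> = (\<lambda>t. {#(+) t ` dir w, (+) (t + w) ` dir v#})"
    and "\<beta> = (\<lambda>t. {#(+) t ` dir u#})"
  have up: "conn (Affine t) (Affine (t + w)) {#(+) t ` dir w#}" for t
    using nz self_in_dir by (intro conn_affine) auto
  have down: "conn (Affine (t + w)) (Affine t) {#(+) t ` dir w#}" for t
  proof -
    have "conn (Affine (t + w)) (Affine t) {#(+) (t + w) ` dir w#}"
      using nz by (intro conn_affine) (auto simp: dir_eq_span vec.span_neg vec.span_base)
    moreover have "(+) (t + w) ` dir w = (+) t ` dir w"
      by (simp add: translate_dir_eq_iff self_in_dir)
    ultimately show ?thesis by simp
  qed
  \<comment> \<open>From \<open>b\<close>, adding \<open>w\<close>, then \<open>v\<close>, leads to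
    \<open>2u\<close>, which lies on the \<open>u\<close>-line through the origin. The value of the
    form at \<open>b\<close> is \<open>2 - 1 - 1 = 0\<close>, and \<open>b \<noteq> 0\<close> is the
    hypothesis \<open>odd\<close>: \<open>u\<close> is not the midpoint of \<open>v\<close> and
    \<open>w\<close>.\<close>
  define b where "b = 2 *s u - v - w"
  have "conn (Affine 0) (Affine 0) (\<Sum>t\<in>ker. \<alpha> t + \<beta> t)"
  proof (rule conn_zigzag_closed[where b = b])
    fix s t
    have "conn (Affine (s + w)) (Affine (t + w)) {#(+) (s + w) ` dir v, (+) (t + w) ` dir v#}"
      by (rule conn_via_infinity[OF dir_in_directions[OF nz(2)]])
    from conn_append[OF conn_append[OF up[of s] this] down[of t]]
    show "conn (Affine s) (Affine t) (\<alpha> s + \<alpha> t)"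
      by (simp add: \<alpha>_def add_mset_commute)
    show "conn (Affine s) (Affine t) (\<beta> s + \<beta> t)"
      using conn_via_infinity[OF dir_in_directions[OF nz(1)], of s t]
      by (simp add: \<beta>_def add_mset_commute)
  next
    assume *: "odd (card ker)"
    \<comment> \<open>In characteristic 2 the nonzero kernel element \<open>u - v\<close> would make
      \<open>card ker\<close> even. Hence \<open>2u \<noteq> 0\<close>, and the last window of the
      return walk has distinct points.\<close>
    have two: "(2::'a) \<noteq> 0"
      using even_card_ker[of "u - v"] * neq u v by (auto simp: ker_def diff)
    have "conn (Affine (b + w)) (Affine (2 *s u)) {#(+) (b + w) ` dir v#}"
      using nz self_in_dir by (intro conn_affine) (auto simp: b_def)
    note conn_append[OF up[of b] this]
    moreover have "conn (Affine (2 *s u)) (Affine 0) {#(+) (2 *s u) ` dir u#}"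
      using nz two by (intro conn_affine)
        (auto simp: dir_eq_span vec.span_neg vec.span_base vec.span_scale)
    moreover have "{#(+) (2 *s u) ` dir u#} = \<beta> 0"
      unfolding \<beta>_def using translate_dir_eq_iff[of "2 *s u" u 0] by simp
    ultimately have "conn (Affine b) (Affine 0)
        ({#(+) b ` dir w#} + {#(+) (b + w) ` dir v#} + \<beta> 0)"
      using conn_append by metis
    then have "conn (Affine b) (Affine 0) (\<alpha> b + \<beta> 0)"
      by (simp add: \<alpha>_def add_mset_commute)
    then show "b \<in> ker \<and> b \<noteq> 0 \<and> conn (Affine b) (Affine 0) (\<alpha> b + \<beta> 0)"
      using u v w odd[OF *] by (simp add: ker_def diff b_def scale)
  qed (simp_all add: zero_in_ker)
  moreover have "(\<Sum>t\<in>ker. \<alpha> t + \<beta> t) = mset_set (lines_along {dir w}) +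
      mset_set (lines_along {dir v}) + mset_set (lines_along {dir u})"
    using lines_along_dir[OF u, of 0] lines_along_dir[OF v, of w] lines_along_dir[OF w, of 0]
    by (simp add: \<alpha>_def \<beta>_def sum.distrib[symmetric] add_mset_commute)
  moreover have "\<dots> = mset_set (lines_along {dir w} \<union> lines_along {dir v} \<union> lines_along {dir u})"
    using lines_along_disjoint[of "{dir w}" "{dir v}"]
      lines_along_disjoint[of "{dir w}" "{dir u}"] lines_along_disjoint[of "{dir v}" "{dir u}"]
      dir_neq[OF v w neq(3)] dir_neq[OF u v neq(1)] dir_neq[OF u w neq(2)]
      nz[THEN dir_in_directions]
    by (subst mset_set_Union, simp, simp, force)+ simp
  moreover have "lines_along {dir w} \<union> lines_along {dir v} \<union> lines_along {dir u} =
      lines_along {dir u, dir v, dir w}"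
    by (auto simp: lines_along_def)
  ultimately show ?thesis by (simp add: solvable_def)
qed

end

section \<open>Pairing off the directions\<close>

lemma linear_form_nth: "linear_form (\<lambda>x. x $ i)"
  by unfold_locales auto

text \<open>Take a coordinate that is nonzero at \<open>u\<close> and one that is nonzero at
  \<open>v\<close>. If neither is nonzero at both vectors, their sum is.\<close>

lemma linear_form_nonzero_at_two:
  fixes u v :: "'a::{field,finite} ^ 'n"
  assumes "u \<noteq> 0" "v \<noteq> 0"
  obtains \<phi> where "linear_form \<phi>" "\<phi> u \<noteq> 0" "\<phi> v \<noteq> 0"
proof -
  obtain i j where ij: "u $ i \<noteq> 0" "v $ j \<noteq> 0"
    using assms by (auto simp: vec_eq_iff)
  have "linear_form (\<lambda>x::'a^'n. x $ i + x $ j)"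
    by unfold_locales (auto simp: algebra_simps)
  then show thesis
    using ij that linear_form_nth[of i] linear_form_nth[of j]
    by (metis (no_types, lifting) add.left_neutral add.right_neutral)
qed

lemma solvable_two_directions:
  fixes l l' :: "('a::{field,finite} ^ 'n) set"
  assumes "l \<in> directions" "l' \<in> directions" "l \<noteq> l'"
  shows "solvable {l, l'}"
proof -
  obtain u v where uv: "u \<noteq> 0" "l = dir u" "v \<noteq> 0" "l' = dir v"
    using assms by (metis directionsE)
  obtain \<phi> where \<phi>: "linear_form \<phi>" "\<phi> u \<noteq> 0" "\<phi> v \<noteq> 0"
    using linear_form_nonzero_at_two[OF uv(1,3)] .
  interpret linear_form \<phi> by fact
  let ?u = "inverse (\<phi> u) *s u" and ?v = "inverse (\<phi> v) *s v"
  have d: "l = dir ?u" "l' = dir ?v" using uv \<phi> by (simp_all add: dir_scale)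
  then have "?u \<noteq> ?v" using assms(3) by metis
  then show ?thesis
    using \<phi> d solvable_pair[of ?u ?v] by (simp add: scale)
qed

lemma solvable_even:
  fixes D :: "('a::{field,finite} ^ 'n) set set"
  assumes "D \<subseteq> directions" "even (card D)"
  shows "solvable D"
  using assms
proof (induction "card D" arbitrary: D rule: less_induct)
  case less
  show ?case
  proof (cases "D = {}")
    case True
    then show ?thesis
      by (simp add: solvable_def lines_along_def conn_Nil Affine_in_PG_points)
  next
    case False
    then obtain l where l: "l \<in> D" by blast
    have "D \<noteq> {l}" using less.prems by auto
    then obtain l' where l': "l' \<in> D" "l' \<noteq> l" using l by blast
    define D' where "D' = D - {l, l'}"
    have D: "D = {l, l'} \<union> D'" "l \<notin> insert l' D'" "l' \<notin> D'"
      using l l' by (auto simp: D'_def)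
    then have "card D = Suc (Suc (card D'))" by simp
    then have "solvable D'" using less.prems D by (intro less.hyps) auto
    then show ?thesis
      using less.prems D solvable_two_directions[of l l'] unfolding D(1)
      by (intro solvable_Un) auto
  qed
qed

text \<open>Removing three directions from an odd number leaves an even number, which can be paired
  off.\<close>

lemma solvable_directions_from_triple:
  fixes l1 l2 l3 :: "('a::{field,finite} ^ 'n) set"
  assumes "solvable {l1, l2, l3}" "{l1, l2, l3} \<subseteq> directions" "card {l1, l2, l3} = 3"
    and "odd (card (directions :: ('a ^ 'n) set set))"
  shows "solvable (directions :: ('a ^ 'n) set set)"
proof -
  let ?D = "directions - {l1, l2, l3}"
  have "card (directions :: ('a ^ 'n) set set) = card ?D + 3"
    using assms(2,3) by (metis card_Diff_subset card_mono finite le_add_diff_inverse2)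
  then have "solvable ?D" using assms(4) by (intro solvable_even) auto
  then have "solvable ({l1, l2, l3} \<union> ?D)"
    using assms(1,2) by (intro solvable_Un) auto
  moreover have "{l1, l2, l3} \<union> ?D = directions" using assms(2) by blast
  ultimately show ?thesis by metis
qed

section \<open>An odd number of directions in dimension at least three\<close>

lemma solvable_directions_dim_ge_3:
  assumes "CARD('n::finite) \<ge> 3"
    and odd: "odd (card (directions :: ('a::{field,finite} ^ 'n) set set))"
  shows "solvable (directions :: ('a ^ 'n) set set)"
proof -
  obtain i j k :: 'n where ijk: "i \<noteq> j" "i \<noteq> k" "j \<noteq> k"
  proof -
    obtain S where "S \<subseteq> (UNIV :: 'n set)" "card S = 3"
      using assms(1) by (meson obtain_subset_with_card_n)
    then show thesis using that by (auto simp: card_3_iff)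
  qed
  interpret linear_form "\<lambda>x::'a^'n. x $ i" by (rule linear_form_nth)
  let ?u = "axis i 1 :: 'a ^ 'n"
  let ?v = "?u + axis j 1" and ?w = "?u + axis k 1"
  have coord: "?u $ i = 1" "?v $ i = 1" "?w $ i = 1" using ijk by (auto simp: axis_def)
  have neq: "?u \<noteq> ?v" "?u \<noteq> ?w" "?v \<noteq> ?w"
    using ijk by (auto simp: axis_eq_axis axis_eq_0_iff)
  \<comment> \<open>Coordinate \<open>k\<close> is 0 on the left and 1 on the right, over every
    field; so \<open>?u\<close> is never the midpoint of \<open>?v\<close> and
    \<open>?w\<close>.\<close>
  have "(2 *s ?u - ?v) $ k \<noteq> ?w $ k" using ijk by (auto simp: axis_def)
  then have "2 *s ?u - ?v \<noteq> ?w" by metis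
  then have "solvable {dir ?u, dir ?v, dir ?w}"
    using coord neq by (intro solvable_triple)
  moreover have "?u \<noteq> 0" "?v \<noteq> 0" "?w \<noteq> 0" using coord by (metis zero_index zero_neq_one)+
  then have "{dir ?u, dir ?v, dir ?w} \<subseteq> directions" using dir_in_directions by auto
  moreover have "card {dir ?u, dir ?v, dir ?w} = 3"
    using dir_neq[OF coord(1,2) neq(1)] dir_neq[OF coord(1,3) neq(2)] dir_neq[OF coord(2,3) neq(3)]
    by simp
  ultimately show ?thesis using odd by (rule solvable_directions_from_triple)
qed

section \<open>An odd number of directions in the plane\<close>

lemma vec_eqI_dim_2:
  fixes x y :: "'a ^ 'n"
  assumes "UNIV = {i, j}" "x $ i = y $ i" "x $ j = y $ j"
  shows "x = y"
  using assms by (metis UNIV_I empty_iff insertE vec_eq_iff)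

text \<open>Either coordinate \<open>i\<close> vanishes and the direction is vertical, or dividing
  by it leaves a slope \<open>a\<close>.\<close>

lemma directions_dim_2:
  fixes i j :: "'n::finite"
  assumes "UNIV = {i, j}" "i \<noteq> j"
  shows "(directions :: ('a::field ^ 'n) set set) =
    insert (dir (axis j 1)) (range (\<lambda>a. dir (axis i 1 + a *s axis j 1)))"
    (is "_ = insert (dir ?f) (range (\<lambda>a. dir (?e a)))")
proof (intro equalityI subsetI)
  fix l :: "('a ^ 'n) set"
  assume "l \<in> directions"
  then obtain u where u: "u \<noteq> 0" "l = dir u" by (rule directionsE)
  show "l \<in> insert (dir ?f) (range (\<lambda>a. dir (?e a)))"
  proof (cases "u $ i = 0")
    case True
    have eq: "u = u $ j *s ?f"
      using assms True by (intro vec_eqI_dim_2[OF assms(1)]) (auto simp: axis_def)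
    then have "u $ j \<noteq> 0" using u(1) by auto
    then show ?thesis using eq u(2) dir_scale by (metis insertI1)
  next
    case False
    have "u = u $ i *s ?e (u $ j / u $ i)"
      using assms False by (intro vec_eqI_dim_2[OF assms(1)]) (auto simp: axis_def)
    then have "l = dir (?e (u $ j / u $ i))" using False u(2) dir_scale by metis
    then show ?thesis by blast
  qed
next
  fix l :: "('a ^ 'n) set"
  assume "l \<in> insert (dir ?f) (range (\<lambda>a. dir (?e a)))"
  moreover have "?e a $ i = 1" for a using assms by (simp add: axis_def)
  then have "?e a \<noteq> 0" for a by (metis zero_index zero_neq_one)
  ultimately show "l \<in> directions"
    by (auto intro!: dir_in_directions simp: axis_eq_0_iff)
qed

lemma solvable_directions_dim_2:
  assumes "CARD('n::finite) = 2"
    and odd: "odd (card (directions :: ('a::{field,finite} ^ 'n) set set))"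
  shows "solvable (directions :: ('a ^ 'n) set set)"
proof -
  obtain i j :: 'n where ij: "UNIV = {i, j}" "i \<noteq> j"
    using assms(1) by (auto simp: card_2_iff)
  define f where "f = (axis j 1 :: 'a ^ 'n)"
  define e where "e = (\<lambda>a. axis i 1 + a *s f)"
  have coord: "f $ i = 0" "f $ j = 1" "e a $ i = 1" "e a $ j = a" for a
    using ij by (auto simp: f_def e_def axis_def)
  interpret I: linear_form "\<lambda>x::'a^'n. x $ i" by (rule linear_form_nth)
  interpret J: linear_form "\<lambda>x::'a^'n. x $ j" by (rule linear_form_nth)
  have nz: "f \<noteq> 0" "e a \<noteq> 0" for a using coord by (metis zero_index zero_neq_one)+
  have dirs: "(directions :: ('a ^ 'n) set set) = insert (dir f) (range (\<lambda>a. dir (e a)))"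
    unfolding e_def f_def by (rule directions_dim_2[OF ij])
  have e_neq: "dir (e a) \<noteq> dir (e b)" if "a \<noteq> b" for a b
    using that coord(3,4) I.dir_neq by metis
  have f_neq: "dir f \<noteq> dir (e a)" for a
  proof
    assume "dir f = dir (e a)"
    then obtain c where "e a = c *s f" using self_in_dir[of "e a"] by (auto simp: dir_def)
    then have "e a $ i = (c *s f) $ i" by simp
    then show False by (simp add: coord)
  qed
  have kerI: "I.ker = range (\<lambda>c. c *s f)"
  proof (intro equalityI subsetI)
    fix x assume "x \<in> I.ker"
    then have "x = x $ j *s f"
      by (intro vec_eqI_dim_2[OF ij(1)]) (auto simp: I.ker_def coord)
    then show "x \<in> range (\<lambda>c. c *s f)" by blast
  qed (auto simp: I.ker_def coord)
  have "inj (\<lambda>c. c *s f)" using nz by (auto simp: inj_def)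
  then have cardT: "card I.ker = CARD('a)" by (simp add: kerI card_image)
  have "inj (\<lambda>a. dir (e a))" using e_neq by (meson injI)
  \<comment> \<open>One direction per slope and the vertical one; so an odd count means that
    \<open>q\<close> is even.\<close>
  then have "card (directions :: ('a ^ 'n) set set) = CARD('a) + 1"
    using f_neq by (simp add: dirs card_image image_iff)
  then have q: "even (CARD('a))" using odd by simp
  show ?thesis
  proof (cases "\<exists>a::'a. a \<noteq> 0 \<and> a \<noteq> 1")
    case True
    then obtain a :: 'a where a: "a \<noteq> 0" "a \<noteq> 1" by blast
    have "e x \<noteq> e y" if "x \<noteq> y" for x y using that coord by metis
    \<comment> \<open>Any three slopes work: the kernel has \<open>q\<close> elements, an even
      number, so no return walk is required.\<close>
    then have "solvable {dir (e 0), dir (e 1), dir (e a)}"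
      using a cardT q coord by (intro I.solvable_triple) auto
    moreover have "{dir (e 0), dir (e 1), dir (e a)} \<subseteq> directions"
      using nz dir_in_directions by auto
    moreover have "card {dir (e 0), dir (e 1), dir (e a)} = 3"
      using a e_neq[of 0 1] e_neq[of 0 a] e_neq[of 1 a] by simp
    ultimately show ?thesis using odd by (rule solvable_directions_from_triple)
  next
    case False
    then have U: "(UNIV :: 'a set) = {0, 1}" by auto
    \<comment> \<open>Here \<open>q = 2\<close> and \<open>e 1 = e 0 + f\<close>, so no linear form
      is 1 at all three vectors. The lines are listed with two forms instead: \<open>I\<close> for
      \<open>e 0\<close>, \<open>J\<close> for \<open>f\<close> and \<open>e 1\<close>.\<close>
    have D: "directions = {dir (e 0), dir f, dir (e 1)}" unfolding dirs U by auto
    have kI: "I.ker = {0, f}" by (auto simp: kerI U)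
    have kJ: "J.ker = {0, e 0}"
    proof (intro equalityI subsetI)
      fix x assume "x \<in> J.ker"
      then have "x = x $ i *s e 0"
        by (intro vec_eqI_dim_2[OF ij(1)]) (auto simp: J.ker_def coord)
      moreover have "x $ i \<in> {0, 1}" using U by blast
      ultimately show "x \<in> {0, e 0}" by fastforce
    qed (auto simp: J.ker_def coord)
    \<comment> \<open>The hexagon \<open>0, [e 0], f, [f], e 0, [e 1]\<close>, where brackets denote
      the points at infinity.\<close>
    have "conn (Affine 0) (Affine 0) ({#(+) 0 ` dir (e 0), (+) f ` dir (e 0)#} +
        {#(+) f ` dir f, (+) (e 0) ` dir f#} + {#(+) (e 0) ` dir (e 1), (+) 0 ` dir (e 1)#})"
      by (rule conn_append[OF conn_append[of _ "Affine f" _ "Affine (e 0)"]];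
        intro conn_via_infinity dir_in_directions nz)
    moreover have "(+) f ` dir f = (+) 0 ` dir f"
      unfolding translate_dir_eq_iff by (simp add: self_in_dir)
    moreover have "{#(+) 0 ` dir (e 0), (+) f ` dir (e 0)#} = mset_set (lines_along {dir (e 0)})"
      using nz(1) by (subst I.lines_along_dir[where w = 0]) (auto simp: coord kI)
    moreover have "{#(+) 0 ` dir f, (+) (e 0) ` dir f#} = mset_set (lines_along {dir f})"
      using nz(2)[of 0] by (subst J.lines_along_dir[where w = 0]) (auto simp: coord kJ)
    moreover have "{#(+) (e 0) ` dir (e 1), (+) 0 ` dir (e 1)#} = mset_set (lines_along {dir (e 1)})"
      using nz(2)[of 0] by (subst J.lines_along_dir[where w = 0]) (auto simp: coord kJ)
    moreover have "mset_set (lines_along {dir (e 0)}) + mset_set (lines_along {dir f}) +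
        mset_set (lines_along {dir (e 1)}) =
        mset_set (lines_along {dir (e 0)} \<union> lines_along {dir f} \<union> lines_along {dir (e 1)})"
      using lines_along_disjoint[of "{dir (e 0)}" "{dir f}"]
        lines_along_disjoint[of "{dir (e 0)}" "{dir (e 1)}"]
        lines_along_disjoint[of "{dir f}" "{dir (e 1)}"]
        f_neq[of 0] f_neq[of 1] e_neq[of 0 1] nz[THEN dir_in_directions]
      by (subst mset_set_Union, simp, simp, force)+ simp
    moreover have "lines_along {dir (e 0)} \<union> lines_along {dir f} \<union> lines_along {dir (e 1)} =
        lines_along directions"
      by (auto simp: lines_along_def D)
    ultimately show ?thesis unfolding solvable_def by metis
  qed
qed

section \<open>From a closed walk to the cyclic sequence\<close>

theorem mainTheorem1:
  assumes "CARD('n::finite) \<ge> 2"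
  shows "\<exists>(N::nat) (p :: nat \<Rightarrow> ('a::{field,finite} ^ 'n) pg_point).
    N \<ge> 1 \<and>
    (\<forall>i<N. p i \<in> PG_points) \<and>
    (\<forall>i<N. \<exists>!L. L \<in> affine_lines \<and> represents (p i) (p ((i + 1) mod N)) L) \<and>
    (\<forall>L \<in> affine_lines. \<exists>!i. i < N \<and> represents (p i) (p ((i + 1) mod N)) L)"
proof -
  have "solvable (directions :: ('a ^ 'n) set set)"
  proof (cases "even (card (directions :: ('a ^ 'n) set set))")
    case True
    then show ?thesis by (intro solvable_even) auto
  next
    case False
    then show ?thesis
      using assms solvable_directions_dim_2[where 'n = 'n and 'a = 'a]
        solvable_directions_dim_ge_3[where 'n = 'n and 'a = 'a]
      by (cases "CARD('n) = 2") auto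
  qed
  moreover have "lines_along directions = (affine_lines :: ('a ^ 'n) set set)"
    by (simp add: lines_along_def affine_lines_def)
  ultimately have "conn (Affine 0) (Affine 0) (mset_set (affine_lines :: ('a ^ 'n) set set))"
    by (simp add: solvable_def)
  then obtain ps :: "('a ^ 'n) pg_point list" and Ls where ps:
    "length ps = Suc (length Ls)" "ps ! 0 = ps ! length Ls" "set ps \<subseteq> PG_points"
    "mset Ls = mset_set affine_lines"
    "\<And>i. i < length Ls \<Longrightarrow> represents (ps ! i) (ps ! Suc i) (Ls ! i)"
    by (metis conn_imp_lists)
  have Ls: "set Ls = affine_lines"
    using ps(4) by (metis finite finite_set_mset_mset_set set_mset_mset)
  moreover have "length Ls = card (affine_lines :: ('a ^ 'n) set set)"
    using ps(4) by (metis size_mset size_mset_set)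
  \<comment> \<open>The list has as many entries as there are lines and contains all of them, so no
    line is repeated.\<close>
  ultimately have "distinct Ls" by (simp add: card_distinct)
  define N where "N = length Ls"
  have "(affine_lines :: ('a ^ 'n) set set) \<noteq> {}"
    using dir_in_directions[of "1 :: 'a ^ 'n"] by (auto simp: affine_lines_def)
  then have "N \<ge> 1" using Ls by (cases Ls) (auto simp: N_def)
  \<comment> \<open>\<open>ps\<close> has \<open>N + 1\<close> entries, the last equal to the first;
    reading indices modulo \<open>N\<close> therefore closes the cycle.\<close>
  have mod: "ps ! ((i + 1) mod N) = ps ! Suc i" if "i < N" for i
    using that ps(2) by (cases "Suc i = N") (auto simp: N_def)
  have rep: "represents (ps ! i) (ps ! ((i + 1) mod N)) L \<longleftrightarrow> L = Ls ! i" if "i < N" for i L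
    using ps(5)[of i] that represents_unique mod[OF that] by (metis N_def)
  show ?thesis
  proof (intro exI conjI allI impI ballI)
    show "N \<ge> 1" by fact
    show "ps ! i \<in> PG_points" if "i < N" for i
      using that ps(1,3) by (auto simp: N_def)
    show "\<exists>!L. L \<in> affine_lines \<and> represents (ps ! i) (ps ! ((i + 1) mod N)) L" if "i < N" for i
      using rep[OF that] that Ls by (auto simp: N_def)
    show "\<exists>!i. i < N \<and> represents (ps ! i) (ps ! ((i + 1) mod N)) L" if "L \<in> affine_lines" for L
    proof -
      have "L \<in> set Ls" using that Ls by simp
      then obtain i where i: "i < N" "Ls ! i = L" by (auto simp: in_set_conv_nth N_def)
      show ?thesis
      proof (rule ex1I[of _ i])
        show "i < N \<and> represents (ps ! i) (ps ! ((i + 1) mod N)) L" using i rep by simp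
        show "k = i" if "k < N \<and> represents (ps ! k) (ps ! ((k + 1) mod N)) L" for k
        proof -
          have "Ls ! k = Ls ! i" using that rep i by metis
          then show ?thesis
            using that i nth_eq_iff_index_eq[OF \<open>distinct Ls\<close>, of k i] by (simp add: N_def)
        qed
      qed
    qed
  qed
qed

end
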